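(* Let $q=(q_1,q_2,\dots)$ be an increasing sequence of positive integers that is a super growth sequence, i.e. $q_n>2\sum_{1\le k<n}q_k$ for all $n$, and let $(X,\mathcal B,m,T)$ be the dyadic tower with growth sequence $q$. Then $(X,\mathcal B,m,T)$ is not subsequence rationally weakly mixing.
   Context: Here $\mathbb N=\{1,2,\dots\}$. Dyadic towers. Let $\Omega:=\{0,1\}^{\mathbb N}$, let $P=\prod(\tfrac12,\tfrac12)$ be the symmetric product probability measure on $\Omega$, and let $\tau:\Omega\to\Omega$ be the dyadic odometer, defined ($P$-a.e.) by $$\tau(1,\dots,1,0,\omega_{\ell+1},\dots)=(0,\dots,0,1,\omega_{\ell+1},\dots),\qquad \ell=\ell(\omega):=\min\{n\ge 1:\ \omega_n=0\}.$$ An increasing sequence $q\in\mathbb N^{\mathbb N}$ is a growth sequence if $q_n>\sum_{1\le k<n}q_k$ for all $n$ (every super growth sequence is a growth sequence). The dyadic cocycle $\varphi:\Omega\to\mathbb N$ associated to a growth sequence $q$ is $$\varphi(\omega):=q_{\ell(\omega)}-\sum_{k=1}^{\ell(\omega)-1}q_k.$$ The dyadic tower with growth sequence $q$ is the tower over $(\Omega,\mathcal B(\Omega),P,\tau)$ with height function $\varphi$, i.e. the measure preserving transformation $(X,\mathcal B,m,T)$ with $X:=\{(x,n)\in\Omega\times\mathbb N:\ 1\le n\le\varphi(x)\}$, $m(A\times\{n\}):=P(A\cap[\varphi\ge n])$, and $T(x,n)=(x,n+1)$ if $\varphi(x)\ge n+1$, $T(x,n)=(\tau x,1)$ if $\varphi(x)=n$.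 It is a conservative, ergodic, measure preserving transformation. Subsequence rational weak mixing. Let $(X,\mathcal B,m,T)$ be a conservative, ergodic, measure preserving transformation of a $\sigma$-finite measure space. Let $\mathcal F_+:=\{F\in\mathcal B:\ 0<m(F)<\infty\}$. For $F\in\mathcal F_+$ put $u_k(F):=\frac{m(F\cap T^{-k}F)}{m(F)^2}$ and $a_n(F):=\sum_{k=0}^{n-1}u_k(F)$. For an infinite subset $K\subset\mathbb N$, $T$ is rationally weakly mixing along $K$ if there exists $F\in\mathcal F_+$ such that $$\frac1{a_n(F)}\sum_{k=0}^{n-1}\left|m(A\cap T^{-k}B)-m(A)m(B)u_k(F)\right|\longrightarrow 0\quad\text{as } n\to\infty,\ n\in K$$ for all measurable $A,B\subset F$. $T$ is subsequence rationally weakly mixing if it is rationally weakly mixing along some infinite $K\subset\mathbb N$. *)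

theory Defs
  imports "HOL-Probability.Probability"
begin

text \<open>All sequences are indexed by the positive integers: points of \<open>{0,1}\<^sup>\<nat>\<close> are
  extensional functions on \<open>{1..}\<close>, and a growth sequence \<open>q\<close> is only ever used at
  indices \<open>n \<ge> 1\<close>.\<close>

definition dyadic_space :: "(nat \<Rightarrow> nat) measure" where
  "dyadic_space = (\<Pi>\<^sub>M n\<in>{1::nat..}. uniform_count_measure {0, 1})"

definition has_zero :: "(nat \<Rightarrow> nat) \<Rightarrow> bool" where
  "has_zero \<omega> \<longleftrightarrow> (\<exists>n\<ge>1. \<omega> n = 0)"

definition first_zero :: "(nat \<Rightarrow> nat) \<Rightarrow> nat" where
  "first_zero \<omega> = (LEAST n. n \<ge> 1 \<and> \<omega> n = 0)"

text \<open>The odometer and the cocycle are only determined almost everywhere: \<open>first_zero\<close> is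
  meaningless at the point \<open>(1,1,\<dots>)\<close>, which has measure zero. There the odometer
  is completed by \<open>(1,1,\<dots>) \<mapsto> (0,0,\<dots>)\<close> and the cocycle is given the value \<open>1\<close>.\<close>

definition odometer :: "(nat \<Rightarrow> nat) \<Rightarrow> (nat \<Rightarrow> nat)" where
  "odometer \<omega> = (\<lambda>k\<in>{1..}.
     if has_zero \<omega> then
       (if k < first_zero \<omega> then 0 else if k = first_zero \<omega> then 1 else \<omega> k)
     else 0)"

definition super_growth_sequence :: "(nat \<Rightarrow> nat) \<Rightarrow> bool" where
  "super_growth_sequence q \<longleftrightarrow>
     strict_mono_on {1..} q \<and> (\<forall>n\<ge>1. 0 < q n) \<and> (\<forall>n\<ge>1. q n > 2 * (\<Sum>k\<in>{1..<n}. q k))"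

text \<open>For a growth sequence the subtraction of naturals below never truncates.\<close>

definition dyadic_cocycle :: "(nat \<Rightarrow> nat) \<Rightarrow> (nat \<Rightarrow> nat) \<Rightarrow> nat" where
  "dyadic_cocycle q \<omega> =
     (if has_zero \<omega> then q (first_zero \<omega>) - (\<Sum>k\<in>{1..<first_zero \<omega>}. q k) else 1)"

definition tower_space :: "'a measure \<Rightarrow> ('a \<Rightarrow> nat) \<Rightarrow> ('a \<times> nat) set" where
  "tower_space M \<phi> = {(x, n). x \<in> space M \<and> 1 \<le> n \<and> n \<le> \<phi> x}"

definition tower_measure :: "'a measure \<Rightarrow> ('a \<Rightarrow> nat) \<Rightarrow> ('a \<times> nat) measure" where
  "tower_measure M \<phi> = restrict_space (M \<Otimes>\<^sub>M count_space UNIV) (tower_space M \<phi>)"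

definition tower_map :: "('a \<Rightarrow> 'a) \<Rightarrow> ('a \<Rightarrow> nat) \<Rightarrow> 'a \<times> nat \<Rightarrow> 'a \<times> nat" where
  "tower_map \<tau> \<phi> = (\<lambda>(x, n). if n + 1 \<le> \<phi> x then (x, n + 1) else (\<tau> x, 1))"

lemma tower_space_measurable:
  assumes [measurable]: "\<phi> \<in> M \<rightarrow>\<^sub>M count_space UNIV"
  shows "tower_space M \<phi> \<in> sets (M \<Otimes>\<^sub>M count_space UNIV)"
proof -
  have "tower_space M \<phi> = (\<Union>n\<in>{1..}. {x \<in> space M. n \<le> \<phi> x} \<times> {n})"
    by (auto simp: tower_space_def)
  also have "\<dots> \<in> sets (M \<Otimes>\<^sub>M count_space UNIV)"
    by (intro sets.countable_UN'' pair_measureI) auto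
  finally show ?thesis .
qed

lemma emeasure_tower_level:
  assumes phi [measurable]: "\<phi> \<in> M \<rightarrow>\<^sub>M count_space UNIV" and A: "A \<in> sets M" and "1 \<le> n"
  shows "emeasure (tower_measure M \<phi>) ((A \<times> {n}) \<inter> tower_space M \<phi>)
       = emeasure M (A \<inter> {x \<in> space M. n \<le> \<phi> x})"
proof -
  interpret C: sigma_finite_measure "count_space (UNIV :: nat set)"
    by (rule sigma_finite_measure_count_space_countable) simp
  have B: "A \<inter> {x \<in> space M. n \<le> \<phi> x} \<in> sets M"
    using A by measurable
  have eq: "(A \<times> {n}) \<inter> tower_space M \<phi> = (A \<inter> {x \<in> space M. n \<le> \<phi> x}) \<times> {n}"
    using \<open>1 \<le> n\<close> by (auto simp: tower_space_def)
  have "emeasure (tower_measure M \<phi>) ((A \<times> {n}) \<inter> tower_space M \<phi>)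
      = emeasure (M \<Otimes>\<^sub>M count_space UNIV) ((A \<times> {n}) \<inter> tower_space M \<phi>)"
    unfolding tower_measure_def
    by (rule emeasure_restrict_space) (use tower_space_measurable[OF phi] in auto)
  also have "\<dots> = emeasure M (A \<inter> {x \<in> space M. n \<le> \<phi> x})"
    unfolding eq using B by (subst C.emeasure_pair_measure_Times) auto
  finally show ?thesis .
qed

definition dyadic_tower_measure :: "(nat \<Rightarrow> nat) \<Rightarrow> ((nat \<Rightarrow> nat) \<times> nat) measure" where
  "dyadic_tower_measure q = tower_measure dyadic_space (dyadic_cocycle q)"

definition dyadic_tower_map ::
  "(nat \<Rightarrow> nat) \<Rightarrow> (nat \<Rightarrow> nat) \<times> nat \<Rightarrow> (nat \<Rightarrow> nat) \<times> nat" where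
  "dyadic_tower_map q = tower_map odometer (dyadic_cocycle q)"

definition return_rate :: "'a measure \<Rightarrow> ('a \<Rightarrow> 'a) \<Rightarrow> 'a set \<Rightarrow> nat \<Rightarrow> real" where
  "return_rate M T F k = measure M (F \<inter> (T ^^ k) -` F) / (measure M F)\<^sup>2"

definition return_sequence :: "'a measure \<Rightarrow> ('a \<Rightarrow> 'a) \<Rightarrow> 'a set \<Rightarrow> nat \<Rightarrow> real" where
  "return_sequence M T F n = (\<Sum>k<n. return_rate M T F k)"

definition rationally_weakly_mixing_along ::
  "'a measure \<Rightarrow> ('a \<Rightarrow> 'a) \<Rightarrow> nat set \<Rightarrow> bool" where
  "rationally_weakly_mixing_along M T K \<longleftrightarrow>
     (\<exists>F\<in>sets M. 0 < emeasure M F \<and> emeasure M F < \<infinity> \<and>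
       (\<forall>A\<in>sets M. \<forall>B\<in>sets M. A \<subseteq> F \<longrightarrow> B \<subseteq> F \<longrightarrow>
         ((\<lambda>n. (1 / return_sequence M T F n) *
              (\<Sum>k<n. \<bar>measure M (A \<inter> (T ^^ k) -` B)
                       - measure M A * measure M B * return_rate M T F k\<bar>))
           \<longlongrightarrow> 0) (inf sequentially (principal K))))"

definition subsequence_rationally_weakly_mixing :: "'a measure \<Rightarrow> ('a \<Rightarrow> 'a) \<Rightarrow> bool" where
  "subsequence_rationally_weakly_mixing M T \<longleftrightarrow>
     (\<exists>K\<subseteq>{1..}. infinite K \<and> rationally_weakly_mixing_along M T K)"

end

theory Submission
  imports Defs
begin

text \<open>Write \<open>t \<omega> = \<Sum>k. q k * \<omega> k\<close>; formally the cocycle is the coboundary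
  \<open>t (odometer \<omega>) - t \<omega>\<close>, so if \<open>T ^^ k\<close> carries \<open>(x, j)\<close> to \<open>(y, j)\<close> at the same level,
  then \<open>k = \<Sum>i. q i * (y i - x i)\<close>, a finite sum with digits in \<open>{-1, 0, 1}\<close>. Super growth makes
  such an expansion unique, so \<open>k\<close> determines \<open>y i - x i\<close> for every \<open>i\<close>. Given \<open>F\<close>, choose a level
  and a coordinate \<open>i\<close> such that the parts \<open>A0\<close>, \<open>A1\<close> of \<open>F\<close> on that level with \<open>i\<close>-th digit
  \<open>0\<close> resp. \<open>1\<close> both have positive measure. For each \<open>k\<close> at most one of the sets
  \<open>A0 \<inter> T\<^sup>-\<^sup>k A0\<close>, \<open>A0 \<inter> T\<^sup>-\<^sup>k A1\<close> is nonempty, so they cannot both be close to their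
  expected measures.\<close>

section \<open>Digit sums along orbits of the odometer and the tower map\<close>

text \<open>The orbit of such a point never meets the completion of the odometer at \<open>(1,1,\<dots>)\<close>.\<close>

definition frequent_zeros :: "(nat \<Rightarrow> nat) set" where
  "frequent_zeros = {\<omega> \<in> {1..} \<rightarrow>\<^sub>E {0, 1}. \<forall>N. \<exists>n\<ge>N. \<omega> n = 0}"

text \<open>A truncation of the formal series \<open>t\<close>, which diverges at every point with
  infinitely many digits 1. The values are integers because digit changes along an orbit can be
  negative.\<close>

definition digit_sum :: "(nat \<Rightarrow> nat) \<Rightarrow> (nat \<Rightarrow> nat) \<Rightarrow> nat \<Rightarrow> int" where
  "digit_sum q \<omega> n = (\<Sum>k\<in>{1..<n}. int (q k) * int (\<omega> k))"

lemma digit_sum_Suc: "1 \<le> n \<Longrightarrow> digit_sum q \<omega> (Suc n) = digit_sum q \<omega> n + int (q n) * int (\<omega> n)"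
  by (simp add: digit_sum_def)

lemma super_growth_sequenceD:
  assumes "super_growth_sequence q" and "1 \<le> n"
  shows "2 * (\<Sum>k\<in>{1..<n}. q k) < q n"
  using assms unfolding super_growth_sequence_def by blast

lemma frequent_zeros_digit: "\<omega> \<in> frequent_zeros \<Longrightarrow> 1 \<le> k \<Longrightarrow> \<omega> k = 0 \<or> \<omega> k = 1"
  unfolding frequent_zeros_def by (blast dest: PiE_mem)

lemma frequent_zerosD:
  assumes "\<omega> \<in> frequent_zeros"
  shows "has_zero \<omega>" and "1 \<le> first_zero \<omega>" and "\<omega> (first_zero \<omega>) = 0"
    and "\<And>k. 1 \<le> k \<Longrightarrow> k < first_zero \<omega> \<Longrightarrow> \<omega> k = 1"
proof -
  show hz: "has_zero \<omega>"
    using assms unfolding frequent_zeros_def has_zero_def by blast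
  then have *: "1 \<le> first_zero \<omega> \<and> \<omega> (first_zero \<omega>) = 0"
    unfolding has_zero_def first_zero_def by (metis (mono_tags, lifting) LeastI_ex)
  then show "1 \<le> first_zero \<omega>" and "\<omega> (first_zero \<omega>) = 0"
    by auto
  show "\<omega> k = 1" if "1 \<le> k" "k < first_zero \<omega>" for k
  proof -
    have "\<omega> k \<noteq> 0"
      using not_less_Least[OF that(2)[unfolded first_zero_def]] that(1) by simp
    then show ?thesis
      using frequent_zeros_digit[OF assms that(1)] by simp
  qed
qed

text \<open>A carry rewrites only the digits up to \<open>first_zero \<omega>\<close>, so every
  later zero survives.\<close>

lemma odometer_frequent_zeros:
  assumes "\<omega> \<in> frequent_zeros"
  shows "odometer \<omega> \<in> frequent_zeros"
proof -
  have "\<exists>n\<ge>N. odometer \<omega> n = 0" for N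
  proof -
    obtain n where "n \<ge> max (Suc (first_zero \<omega>)) N" "\<omega> n = 0"
      using assms unfolding frequent_zeros_def by blast
    then show ?thesis
      using frequent_zerosD(1)[OF assms] by (intro exI[of _ n]) (auto simp: odometer_def)
  qed
  moreover have "odometer \<omega> \<in> {1..} \<rightarrow>\<^sub>E {0, 1}"
    unfolding odometer_def restrict_PiE_iff using frequent_zeros_digit[OF assms] by simp
  ultimately show ?thesis
    by (simp add: frequent_zeros_def)
qed

text \<open>This is the coboundary identity, exact for every truncation that contains the whole
  carry. Replacing the digits 1...10 by 0...01 removes the weights below
  \<open>first_zero \<omega>\<close> and adds the weight at it, and this net change is the cocycle.
  Later digits are unchanged.\<close>

lemma digit_sum_odometer:
  assumes q: "super_growth_sequence q" and \<omega>: "\<omega> \<in> frequent_zeros" and n: "first_zero \<omega> < n"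
  shows "digit_sum q (odometer \<omega>) n = digit_sum q \<omega> n + int (dyadic_cocycle q \<omega>)"
  \<comment> \<open>The induction starts at \<open>Suc (first_zero \<omega>)\<close>, the first
    truncation that includes the new digit 1.\<close>
  using n[THEN Suc_leI]
proof (induction n rule: dec_induct)
  case base
  let ?l = "first_zero \<omega>"
  note D = frequent_zerosD[OF \<omega>]
  \<comment> \<open>Growth turns the truncated subtraction in the cocycle into a genuine integer
    difference.\<close>
  have less: "(\<Sum>k\<in>{1..<?l}. q k) < q ?l"
    using super_growth_sequenceD[OF q D(2)] by linarith
  have "digit_sum q (odometer \<omega>) ?l = 0"
    unfolding digit_sum_def using D(1) by (intro sum.neutral) (auto simp: odometer_def)
  moreover have "digit_sum q \<omega> ?l = int (\<Sum>k\<in>{1..<?l}. q k)"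
    unfolding digit_sum_def of_nat_sum using D(4) by (intro sum.cong) auto
  moreover have "odometer \<omega> ?l = 1"
    using D(1,2) by (simp add: odometer_def)
  moreover have "int (dyadic_cocycle q \<omega>) = int (q ?l) - int (\<Sum>k\<in>{1..<?l}. q k)"
    using less D(1) by (simp only: dyadic_cocycle_def if_True of_nat_diff less_imp_le)
  ultimately show ?case
    unfolding digit_sum_Suc[OF D(2)] D(3) by simp
next
  case (step n)
  then have "odometer \<omega> n = \<omega> n" "1 \<le> n"
    using frequent_zerosD(1)[OF \<omega>] by (auto simp: odometer_def)
  then show ?case
    using step.IH by (simp only: digit_sum_Suc)
qed

text \<open>An orbit enters the column over each new base point at level 1, so that level must
  exist.\<close>

lemma dyadic_cocycle_pos:
  assumes "super_growth_sequence q" and "\<omega> \<in> frequent_zeros"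
  shows "1 \<le> dyadic_cocycle q \<omega>"
  using super_growth_sequenceD[OF assms(1) frequent_zerosD(2)[OF assms(2)]]
  by (auto simp: dyadic_cocycle_def)

text \<open>Each step raises digit sum plus level by exactly one, for all long truncations. A step
  inside a column raises the level. A step from the top of a column loses all but one of the levels,
  and the digit sum regains the column height by the coboundary identity.\<close>

lemma dyadic_tower_map_orbit:
  assumes q: "super_growth_sequence q" and x: "x \<in> frequent_zeros"
    and j: "1 \<le> j" "j \<le> dyadic_cocycle q x"
    and orbit: "(dyadic_tower_map q ^^ k) (x, j) = (y, l)"
  shows "y \<in> frequent_zeros \<and> 1 \<le> l \<and> l \<le> dyadic_cocycle q y \<and>
    (\<exists>L. \<forall>n\<ge>L. digit_sum q y n + int l = digit_sum q x n + int j + int k)"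
  using orbit
proof (induction k arbitrary: y l)
  case 0
  then show ?case
    using x j by auto
next
  case (Suc k)
  obtain y' l' where 1: "(dyadic_tower_map q ^^ k) (x, j) = (y', l')"
    by fastforce
  then have 2: "tower_map odometer (dyadic_cocycle q) (y', l') = (y, l)"
    using Suc.prems by (simp add: dyadic_tower_map_def)
  obtain L where IH: "y' \<in> frequent_zeros" "1 \<le> l'" "l' \<le> dyadic_cocycle q y'"
    "\<forall>n\<ge>L. digit_sum q y' n + int l' = digit_sum q x n + int j + int k"
    using Suc.IH[OF 1] by blast
  show ?case
  proof (cases "l' + 1 \<le> dyadic_cocycle q y'")
    case True
    then have "y = y'" "l = l' + 1"
      using 2 by (auto simp: tower_map_def)
    then show ?thesis
      using IH True by (auto intro!: exI[of _ L])
  next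
    case False
    then have y: "y = odometer y'" "l = 1" and l': "l' = dyadic_cocycle q y'"
      using 2 IH by (auto simp: tower_map_def)
    \<comment> \<open>The threshold has to grow with the orbit: the truncation must also contain the
      carry performed at \<open>y'\<close>.\<close>
    have "digit_sum q y n + int l = digit_sum q x n + int j + int (Suc k)"
      if n: "n \<ge> max L (Suc (first_zero y'))" for n
    proof -
      have "digit_sum q y n = digit_sum q y' n + int l'"
        unfolding y l' using n by (intro digit_sum_odometer[OF q IH(1)]) simp
      moreover have "digit_sum q y' n + int l' = digit_sum q x n + int j + int k"
        using IH(4) n by simp
      ultimately show ?thesis
        using y by simp
    qed
    moreover have "y \<in> frequent_zeros"
      unfolding y by (rule odometer_frequent_zeros[OF IH(1)])
    ultimately show ?thesis
      using dyadic_cocycle_pos[OF q] y(2)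
      by (intro conjI exI[of _ "max L (Suc (first_zero y'))"]) auto
  qed
qed

section \<open>Uniqueness of expansions and the digits of a return time\<close>

text \<open>With coefficients bounded by 2, super growth makes the terms below the top index add up
  to less than the top weight in absolute value. The top coefficient must therefore vanish, and the
  argument descends to all smaller indices. The bound 2 fits a difference of two expansions with
  digits in {-1, 0, 1}.\<close>

lemma super_growth_expansion_unique:
  fixes d :: "nat \<Rightarrow> int"
  assumes q: "super_growth_sequence q" and d: "\<And>k. 1 \<le> k \<Longrightarrow> \<bar>d k\<bar> \<le> 2"
    and "(\<Sum>k\<in>{1..<n}. int (q k) * d k) = 0" and "1 \<le> i" "i < n"
  shows "d i = 0"
  using assms(3-)
proof (induction n)
  case (Suc n)
  then have n: "1 \<le> n"
    by simp
  let ?s = "\<Sum>k\<in>{1..<n}. int (q k) * d k"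
  have sum: "?s + int (q n) * d n = 0"
    using Suc.prems(1) n by simp
  have "\<bar>?s\<bar> \<le> (\<Sum>k\<in>{1..<n}. \<bar>int (q k) * d k\<bar>)"
    by (rule sum_abs)
  also have "\<dots> \<le> (\<Sum>k\<in>{1..<n}. int (q k) * 2)"
    using d by (intro sum_mono) (auto simp: abs_mult intro!: mult_left_mono)
  also have "\<dots> = int (2 * (\<Sum>k\<in>{1..<n}. q k))"
    by (simp add: sum_distrib_left mult.commute)
  also have "\<dots> < int (q n)"
    using super_growth_sequenceD[OF q n] by (simp only: of_nat_less_iff)
  finally have less: "\<bar>?s\<bar> < int (q n)" .
  have "d n = 0"
  proof (rule ccontr)
    assume "d n \<noteq> 0"
    then have "int (q n) * 1 \<le> int (q n) * \<bar>d n\<bar>"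
      by (intro mult_left_mono) auto
    also have "\<dots> = \<bar>int (q n) * d n\<bar>"
      by (simp add: abs_mult)
    also have "\<dots> = \<bar>?s\<bar>"
      using sum by linarith
    finally show False
      using less by simp
  qed
  then show ?case
    using Suc sum by (cases "i = n") auto
qed simp

text \<open>Start and end lie on the same level \<open>j\<close>, so the levels cancel and both
  digit sum differences equal \<open>k\<close>. Subtracting the two expansions gives zero, and
  uniqueness applies.\<close>

lemma return_time_determines_digits:
  assumes q: "super_growth_sequence q"
    and x: "x \<in> frequent_zeros" "1 \<le> j" "j \<le> dyadic_cocycle q x"
      "(dyadic_tower_map q ^^ k) (x, j) = (y, j)"
    and x': "x' \<in> frequent_zeros" "j \<le> dyadic_cocycle q x'"
      "(dyadic_tower_map q ^^ k) (x', j) = (y', j)"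
    and i: "1 \<le> i"
  shows "int (y i) - int (x i) = int (y' i) - int (x' i)"
proof -
  obtain L where y: "y \<in> frequent_zeros"
    and L: "\<And>n. n \<ge> L \<Longrightarrow> digit_sum q y n = digit_sum q x n + int k"
    using dyadic_tower_map_orbit[OF q x] by auto
  obtain L' where y': "y' \<in> frequent_zeros"
    and L': "\<And>n. n \<ge> L' \<Longrightarrow> digit_sum q y' n = digit_sum q x' n + int k"
    using dyadic_tower_map_orbit[OF q x'(1) x(2) x'(2,3)] by auto
  define d where "d = (\<lambda>m. (int (y m) - int (x m)) - (int (y' m) - int (x' m)))"
  \<comment> \<open>The truncation must reach past index \<open>i\<close> and past both
    thresholds.\<close>
  define n where "n = max (Suc i) (max L L')"
  have "\<bar>d m\<bar> \<le> 2" if "1 \<le> m" for m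
    using frequent_zeros_digit[OF x(1) that] frequent_zeros_digit[OF x'(1) that]
      frequent_zeros_digit[OF y that] frequent_zeros_digit[OF y' that]
    by (auto simp: d_def)
  moreover have "(\<Sum>m\<in>{1..<n}. int (q m) * d m)
      = (digit_sum q y n - digit_sum q x n) - (digit_sum q y' n - digit_sum q x' n)"
    by (simp add: d_def digit_sum_def right_diff_distrib sum_subtractf)
  then have "(\<Sum>m\<in>{1..<n}. int (q m) * d m) = 0"
    using L[of n] L'[of n] by (simp add: n_def)
  ultimately have "d i = 0"
    using q i by (intro super_growth_expansion_unique[of q d n]) (auto simp: n_def)
  then show ?thesis
    by (simp add: d_def)
qed

section \<open>Measurability and null sets in the dyadic space\<close>

lemma space_dyadic_space: "space dyadic_space = {1..} \<rightarrow>\<^sub>E {0, 1}"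
  by (simp add: dyadic_space_def space_PiM space_uniform_count_measure)

lemma measurable_dyadic_coordinate:
  assumes "1 \<le> n"
  shows "(\<lambda>\<omega>. \<omega> n) \<in> dyadic_space \<rightarrow>\<^sub>M count_space UNIV"
proof -
  have "(\<lambda>\<omega>. \<omega> n) \<in> dyadic_space \<rightarrow>\<^sub>M uniform_count_measure {0, 1}"
    unfolding dyadic_space_def using assms by (intro measurable_component_singleton) auto
  moreover have "(\<lambda>x. x) \<in> uniform_count_measure {0, 1::nat} \<rightarrow>\<^sub>M count_space UNIV"
    by (auto simp: measurable_def space_uniform_count_measure sets_uniform_count_measure)
  ultimately show ?thesis
    by (rule measurable_compose)
qed

lemma sets_dyadic_coordinate:
  assumes "1 \<le> n"
  shows "{\<omega> \<in> space dyadic_space. \<omega> n = c} \<in> sets dyadic_space"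
  using measurable_sets[OF measurable_dyadic_coordinate[OF assms], of "{c}"]
  by (simp add: vimage_def Int_def conj_commute)

lemma measurable_dyadic_cocycle: "dyadic_cocycle q \<in> dyadic_space \<rightarrow>\<^sub>M count_space UNIV"
proof -
  have zero: "Measurable.pred dyadic_space (\<lambda>\<omega>. 1 \<le> n \<and> \<omega> n = 0)" for n
  proof (cases "1 \<le> n")
    case True
    then show ?thesis
      using sets_dyadic_coordinate[OF True] by (simp add: pred_def)
  qed simp
  have "Measurable.pred dyadic_space has_zero"
    unfolding has_zero_def by (rule pred_intros_countable(2)[OF zero])
  moreover have "first_zero \<in> dyadic_space \<rightarrow>\<^sub>M count_space UNIV"
    unfolding first_zero_def by (rule measurable_Least[OF zero])
  then have "(\<lambda>\<omega>. q (first_zero \<omega>) - (\<Sum>k\<in>{1..<first_zero \<omega>}. q k))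
      \<in> dyadic_space \<rightarrow>\<^sub>M count_space UNIV"
    by (rule measurable_compose) simp
  ultimately show ?thesis
    unfolding dyadic_cocycle_def by (intro measurable_If) (auto simp: pred_def)
qed

text \<open>The tail condition lies inside cylinders that fix \<open>m\<close> digits and have
  measure at most \<open>(1/2)^m\<close>, for every \<open>m\<close>. The prescribed tail is
  arbitrary because it serves twice: the constant 1 describes points with finitely many zeros, and a
  full digit sequence describes a single point.\<close>

lemma dyadic_tail_null:
  "{\<omega> \<in> space dyadic_space. \<forall>n\<ge>max 1 N. \<omega> n = c n} \<in> null_sets dyadic_space"
  (is "?C \<in> _")
proof -
  let ?U = "\<lambda>_::nat. uniform_count_measure {0, 1::nat}"
  interpret product_prob_space ?U "{1..}"
    by (intro product_prob_space.intro product_sigma_finite.intro product_prob_space_axioms.intro)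
      (auto intro: prob_space_imp_sigma_finite prob_space_uniform_count_measure)
  have "?C = (\<Inter>n\<in>{max 1 N..}. {\<omega> \<in> space dyadic_space. \<omega> n = c n})"
    by auto
  also have "\<dots> \<in> sets dyadic_space"
    by (intro sets.countable_INT') (auto intro: sets_dyadic_coordinate)
  finally have sets: "?C \<in> sets dyadic_space" .
  have le: "emeasure dyadic_space ?C \<le> ennreal ((1/2) ^ m)" for m
  proof -
    let ?J = "{max 1 N..<max 1 N + m}"
    \<comment> \<open>The values of \<open>c\<close> need not be digits. Intersecting with {0, 1}
      keeps each factor measurable, with at most one element.\<close>
    let ?D = "prod_emb {1..} ?U ?J (\<Pi>\<^sub>E n\<in>?J. {c n} \<inter> {0, 1})"
    have "?C \<subseteq> ?D"
    proof
      fix \<omega> assume \<omega>: "\<omega> \<in> ?C"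
      then have E: "\<omega> \<in> {1..} \<rightarrow>\<^sub>E {0, 1}"
        by (simp add: space_dyadic_space)
      have "\<omega> n \<in> {c n} \<inter> {0, 1}" if "n \<in> ?J" for n
        using that \<omega> PiE_mem[OF E, of n] by simp
      then have "restrict \<omega> ?J \<in> (\<Pi>\<^sub>E n\<in>?J. {c n} \<inter> {0, 1})"
        by (simp only: restrict_PiE_iff) blast
      then show "\<omega> \<in> ?D"
        using E by (simp add: prod_emb_def space_uniform_count_measure)
    qed
    moreover have D: "?D \<in> sets dyadic_space"
      unfolding dyadic_space_def
      by (rule sets_PiM_I) (auto simp: sets_uniform_count_measure)
    ultimately have "emeasure dyadic_space ?C \<le> emeasure dyadic_space ?D"
      by (intro emeasure_mono)
    also have "\<dots> = (\<Prod>n\<in>?J. emeasure (uniform_count_measure {0, 1}) ({c n} \<inter> {0, 1}))"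
      unfolding dyadic_space_def
      by (rule emeasure_PiM_emb) (auto simp: sets_uniform_count_measure)
    also have "\<dots> \<le> (\<Prod>n\<in>?J. ennreal (1/2))"
    proof (intro prod_mono_ennreal)
      fix n
      have "card ({c n} \<inter> {0, 1}) \<le> 1"
        using card_mono[of "{c n}" "{c n} \<inter> {0, 1}"] by simp
      then show "emeasure (uniform_count_measure {0, 1}) ({c n} \<inter> {0, 1}) \<le> ennreal (1/2)"
        by (subst emeasure_uniform_count_measure) (auto simp del: ennreal_half intro!: ennreal_leI)
    qed
    also have "\<dots> = ennreal ((1/2) ^ m)"
      by (simp add: ennreal_power del: ennreal_half)
    finally show ?thesis .
  qed
  have "(\<lambda>m. (1/2 :: real) ^ m) \<longlonglongrightarrow> 0"
    by (rule LIMSEQ_power_zero) simp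
  then have lim: "(\<lambda>m. ennreal ((1/2) ^ m)) \<longlonglongrightarrow> ennreal 0"
    by (rule tendsto_ennrealI)
  have "emeasure dyadic_space ?C \<le> ennreal 0"
    by (rule LIMSEQ_le_const[OF lim]) (use le in blast)
  then have "emeasure dyadic_space ?C = 0"
    by simp
  with sets show ?thesis
    by (intro null_setsI)
qed

text \<open>A point without zeros beyond some \<open>N\<close> is constantly 1 from there on, so
  countably many null tail conditions cover the complement.\<close>

lemma frequent_zeros_conull: "space dyadic_space - frequent_zeros \<in> null_sets dyadic_space"
proof -
  have "space dyadic_space - frequent_zeros
      = (\<Union>N. {\<omega> \<in> space dyadic_space. \<forall>n\<ge>max 1 N. \<omega> n = 1})"
  proof (intro equalityI subsetI)
    fix \<omega> assume \<omega>: "\<omega> \<in> space dyadic_space - frequent_zeros"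
    then have E: "\<omega> \<in> {1..} \<rightarrow>\<^sub>E {0, 1}"
      by (simp add: space_dyadic_space)
    with \<omega> have "\<exists>N. \<forall>n\<ge>N. \<omega> n \<noteq> 0"
      by (simp add: frequent_zeros_def)
    then obtain N where N: "\<And>n. n \<ge> N \<Longrightarrow> \<omega> n \<noteq> 0"
      by blast
    have "\<omega> n = 1" if "n \<ge> max 1 N" for n
      using PiE_mem[OF E, of n] N[of n] that by simp
    then show "\<omega> \<in> (\<Union>N. {\<omega> \<in> space dyadic_space. \<forall>n\<ge>max 1 N. \<omega> n = 1})"
      using \<omega> by (intro UN_I[of N]) simp_all
  next
    fix \<omega> assume "\<omega> \<in> (\<Union>N. {\<omega> \<in> space dyadic_space. \<forall>n\<ge>max 1 N. \<omega> n = 1})"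
    then obtain N where \<omega>: "\<omega> \<in> space dyadic_space" and N: "\<And>n. n \<ge> max 1 N \<Longrightarrow> \<omega> n = 1"
      by blast
    have "\<omega> \<notin> frequent_zeros"
    proof
      assume "\<omega> \<in> frequent_zeros"
      then obtain n where "n \<ge> max 1 N" "\<omega> n = 0"
        unfolding frequent_zeros_def by blast
      then show False
        using N[of n] by simp
    qed
    then show "\<omega> \<in> space dyadic_space - frequent_zeros"
      using \<omega> by blast
  qed
  also have "\<dots> \<in> null_sets dyadic_space"
    by (intro null_sets_UN dyadic_tail_null)
  finally show ?thesis .
qed

section \<open>Splitting a set of positive measure in the tower\<close>

lemma sets_tower_restrict:
  assumes "F \<in> sets (tower_measure M \<phi>)" and "B \<in> sets M"
  shows "F \<inter> B \<times> {j} \<in> sets (tower_measure M \<phi>)"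
proof -
  obtain F' where F': "F' \<in> sets (M \<Otimes>\<^sub>M count_space UNIV)" "F = tower_space M \<phi> \<inter> F'"
    using assms(1) unfolding tower_measure_def sets_restrict_space by blast
  have "F' \<inter> B \<times> {j} \<in> sets (M \<Otimes>\<^sub>M count_space UNIV)"
    using F'(1) assms(2) by (intro sets.Int pair_measureI) auto
  then show ?thesis
    unfolding tower_measure_def sets_restrict_space F'(2) Int_assoc by (rule imageI)
qed

lemma sets_tower_subset:
  assumes "F \<in> sets (tower_measure M \<phi>)"
  shows "F \<subseteq> tower_space M \<phi>"
  using assms unfolding tower_measure_def sets_restrict_space by blast

text \<open>A level of the tower carries the base measure restricted to the points whose column
  reaches it, so null sets of the base lift to null sets. Level 0 lies outside the tower.\<close>

lemma null_sets_tower_restrict: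
  assumes \<phi>: "\<phi> \<in> M \<rightarrow>\<^sub>M count_space UNIV"
    and F: "F \<in> sets (tower_measure M \<phi>)" and B: "B \<in> null_sets M"
  shows "F \<inter> B \<times> {j} \<in> null_sets (tower_measure M \<phi>)"
proof (cases "1 \<le> j")
  case True
  have X: "tower_space M \<phi> \<in> sets (tower_measure M \<phi>)"
    using imageI[OF tower_space_measurable[OF \<phi>], of "(\<inter>) (tower_space M \<phi>)"]
    unfolding tower_measure_def sets_restrict_space by (simp only: Int_absorb)
  have "emeasure (tower_measure M \<phi>) (B \<times> {j} \<inter> tower_space M \<phi>)
      = emeasure M (B \<inter> {x \<in> space M. j \<le> \<phi> x})"
    by (rule emeasure_tower_level[OF \<phi> null_setsD2[OF B] True])
  also have "\<dots> = 0"
    by (rule emeasure_eq_0[OF null_setsD2[OF B] null_setsD1[OF B] Int_lower1])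
  finally have "tower_space M \<phi> \<inter> B \<times> {j} \<in> null_sets (tower_measure M \<phi>)"
    unfolding Int_commute[of "B \<times> {j}"]
    by (rule null_setsI[OF _ sets_tower_restrict[OF X null_setsD2[OF B]]])
  then show ?thesis
    by (rule null_sets_subset[OF _ sets_tower_restrict[OF F null_setsD2[OF B]]])
      (rule Int_mono[OF sets_tower_subset[OF F] order_refl])
next
  case False
  have "tower_space M \<phi> \<inter> B \<times> {j} = {}"
    using False by (auto simp: tower_space_def)
  then have "F \<inter> B \<times> {j} = {}"
    using sets_tower_subset[OF F] by blast
  then show ?thesis
    by (simp only: null_sets.empty_sets)
qed

text \<open>Since there are countably many levels, some level \<open>j\<close> meets
  \<open>F\<close> over \<open>frequent_zeros\<close> in a non-null set. If every digit were almost
  everywhere constant on that set, almost all of it would lie over one base point, which is null.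
  Hence some digit takes both values with positive measure.\<close>

lemma dyadic_tower_split:
  assumes F: "F \<in> sets (dyadic_tower_measure q)" and pos: "0 < emeasure (dyadic_tower_measure q) F"
  obtains i j A0 A1 where "1 \<le> i" "1 \<le> j"
    "A0 \<in> sets (dyadic_tower_measure q)" "A1 \<in> sets (dyadic_tower_measure q)"
    "A0 \<subseteq> F" "A1 \<subseteq> F"
    "0 < emeasure (dyadic_tower_measure q) A0" "0 < emeasure (dyadic_tower_measure q) A1"
    "A0 \<subseteq> {x \<in> frequent_zeros. j \<le> dyadic_cocycle q x \<and> x i = 0} \<times> {j}"
    "A1 \<subseteq> {x \<in> frequent_zeros. j \<le> dyadic_cocycle q x \<and> x i = 1} \<times> {j}"
proof -
  let ?M = "dyadic_tower_measure q"
  let ?S = "space dyadic_space"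
  let ?G = "?S \<inter> frequent_zeros"
  note restrict = sets_tower_restrict[where M = dyadic_space and \<phi> = "dyadic_cocycle q",
      folded dyadic_tower_measure_def]
  note null_restrict = null_sets_tower_restrict[OF measurable_dyadic_cocycle,
      of _ q, folded dyadic_tower_measure_def]
  have F_sub: "F \<subseteq> tower_space dyadic_space (dyadic_cocycle q)"
    using F sets_tower_subset unfolding dyadic_tower_measure_def by blast
  then have F_space: "F \<subseteq> ?S \<times> UNIV"
    by (auto simp: tower_space_def)
  have G: "?G \<in> sets dyadic_space"
    using sets.compl_sets[OF null_setsD2[OF frequent_zeros_conull]]
    by (simp add: Diff_Diff_Int)
  have "\<exists>j. F \<inter> ?G \<times> {j} \<notin> null_sets ?M"
  proof (rule ccontr)
    assume "\<not> ?thesis"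
    then have "F \<inter> ?G \<times> {j} \<in> null_sets ?M" for j
      by blast
    then have "(\<Union>j. F \<inter> ?G \<times> {j}) \<union> (\<Union>j. F \<inter> (?S - frequent_zeros) \<times> {j}) \<in> null_sets ?M"
      by (intro null_sets.Un null_sets_UN null_restrict[OF F frequent_zeros_conull])
    moreover have "(\<Union>j. F \<inter> ?G \<times> {j}) \<union> (\<Union>j. F \<inter> (?S - frequent_zeros) \<times> {j}) = F"
      using F_space by blast
    ultimately have "F \<in> null_sets ?M"
      by (simp only:)
    then show False
      using pos null_setsD1[of F ?M] by simp
  qed
  then obtain j where j: "F \<inter> ?G \<times> {j} \<notin> null_sets ?M"
    by blast
  define H where "H = F \<inter> ?G \<times> {j}"
  have H: "H \<in> sets ?M"
    unfolding H_def by (rule restrict[OF F G])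
  define A where "A = (\<lambda>i c. H \<inter> {\<omega> \<in> ?S. \<omega> i = c} \<times> {j})"
  have A: "A i c \<in> sets ?M" if "1 \<le> i" for i c
    unfolding A_def by (rule restrict[OF H sets_dyadic_coordinate[OF that]])
  have "\<exists>i\<ge>1. A i 0 \<notin> null_sets ?M \<and> A i 1 \<notin> null_sets ?M"
  proof (rule ccontr)
    assume "\<not> ?thesis"
    then have "\<forall>i. \<exists>c. c \<in> {0, 1} \<and> (1 \<le> i \<longrightarrow> A i c \<in> null_sets ?M)"
      by blast
    \<comment> \<open>Here \<open>c i\<close> is a digit that almost no point of \<open>H\<close>
      has at coordinate \<open>i\<close>.\<close>
    then obtain c where c: "\<And>i. c i \<in> {0, 1}" "\<And>i. 1 \<le> i \<Longrightarrow> A i (c i) \<in> null_sets ?M"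
      using choice[of "\<lambda>i c. c \<in> {0, 1} \<and> (1 \<le> i \<longrightarrow> A i c \<in> null_sets ?M)"] by blast
    \<comment> \<open>This is the single sequence \<open>1 - c\<close>. The form
      \<open>max 1 1\<close> matches \<open>dyadic_tail_null\<close> with
      \<open>N = 1\<close>.\<close>
    let ?C = "{\<omega> \<in> ?S. \<forall>n\<ge>max 1 1. \<omega> n = 1 - c n}"
    have "(\<Union>i\<in>{1..}. A i (c i)) \<union> H \<inter> ?C \<times> {j} \<in> null_sets ?M"
      by (rule null_sets.Un[OF null_sets_UN' null_restrict[OF H dyadic_tail_null]])
        (simp_all add: c(2))
    moreover have "H \<subseteq> (\<Union>i\<in>{1..}. A i (c i)) \<union> H \<inter> ?C \<times> {j}"
    proof
      fix p assume p: "p \<in> H"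
      then obtain \<omega> where \<omega>: "p = (\<omega>, j)" "\<omega> \<in> ?S"
        unfolding H_def by blast
      show "p \<in> (\<Union>i\<in>{1..}. A i (c i)) \<union> H \<inter> ?C \<times> {j}"
      proof (cases "\<exists>i\<ge>1. \<omega> i = c i")
        case True
        then obtain i where i: "1 \<le> i" "\<omega> i = c i"
          by blast
        then have "p \<in> A i (c i)"
          using p \<omega> by (simp add: A_def)
        then show ?thesis
          using i by (intro UnI1 UN_I[of i]) simp_all
      next
        case False
        have "\<omega> n = 1 - c n" if "n \<ge> 1" for n
        proof -
          have "\<omega> n \<in> {0, 1}"
            using \<omega>(2) that PiE_mem[of \<omega> "{1..}" "\<lambda>_. {0, 1}" n] by (simp add: space_dyadic_space)
          then show ?thesis
            using False that c(1)[of n] by auto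
        qed
        then show ?thesis
          using p \<omega> by simp
      qed
    qed
    ultimately have "H \<in> null_sets ?M"
      using null_sets_subset[OF _ H] by blast
    then show False
      using j by (simp add: H_def)
  qed
  then obtain i where i: "1 \<le> i" "A i 0 \<notin> null_sets ?M" "A i 1 \<notin> null_sets ?M"
    by blast
  have "1 \<le> j"
  proof (rule ccontr)
    assume "\<not> 1 \<le> j"
    then have "H = {}"
      using F_sub by (auto simp: H_def tower_space_def)
    then show False
      using j by (simp add: H_def)
  qed
  moreover have "0 < emeasure ?M (A i 0)" "0 < emeasure ?M (A i 1)"
    using i(2,3) null_setsI[OF _ A[OF i(1)]] by (auto simp only: zero_less_iff_neq_zero)
  moreover have "A i c \<subseteq> {x \<in> frequent_zeros. j \<le> dyadic_cocycle q x \<and> x i = c} \<times> {j}" for c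
    using F_sub unfolding A_def H_def tower_space_def by blast
  moreover have "A i c \<subseteq> F" for c
    unfolding A_def H_def by blast
  ultimately show thesis
    by (intro that[OF i(1) _ A[OF i(1), of 0] A[OF i(1), of 1]])
qed

section \<open>The obstruction to rational weak mixing\<close>

text \<open>For each \<open>k\<close>, an empty intersection makes the corresponding error equal to
  the whole product term. The errors for the pairs (A, A) and (A, B) thus add up to at least a fixed
  positive multiple of the return rate, so their normalised sums cannot both tend to 0.\<close>

lemma not_rationally_weakly_mixing_alongI:
  fixes M :: "'a measure"
  assumes K: "infinite K"
    and split: "\<And>F. F \<in> sets M \<Longrightarrow> 0 < emeasure M F \<Longrightarrow>
      \<exists>A\<in>sets M. \<exists>B\<in>sets M. A \<subseteq> F \<and> B \<subseteq> F \<and> 0 < emeasure M A \<and> 0 < emeasure M B \<and>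
        (\<forall>k. A \<inter> (T ^^ k) -` A = {} \<or> A \<inter> (T ^^ k) -` B = {})"
  shows "\<not> rationally_weakly_mixing_along M T K"
proof
  assume "rationally_weakly_mixing_along M T K"
  then obtain F where F: "F \<in> sets M" "0 < emeasure M F" "emeasure M F < \<infinity>"
    and lim_all: "\<forall>A\<in>sets M. \<forall>B\<in>sets M. A \<subseteq> F \<longrightarrow> B \<subseteq> F \<longrightarrow>
         ((\<lambda>n. (1 / return_sequence M T F n) *
              (\<Sum>k<n. \<bar>measure M (A \<inter> (T ^^ k) -` B)
                       - measure M A * measure M B * return_rate M T F k\<bar>))
           \<longlongrightarrow> 0) (inf sequentially (principal K))"
    unfolding rationally_weakly_mixing_along_def by (elim bexE conjE)
  note lim = lim_all[rule_format]
  obtain A B where A: "A \<in> sets M" "A \<subseteq> F" "0 < emeasure M A"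
    and B: "B \<in> sets M" "B \<subseteq> F" "0 < emeasure M B"
    and disj: "\<forall>k. A \<inter> (T ^^ k) -` A = {} \<or> A \<inter> (T ^^ k) -` B = {}"
    using split[OF F(1,2)] by (elim bexE conjE)
  have measure_pos: "0 < measure M C" if "C \<in> sets M" "C \<subseteq> F" "0 < emeasure M C" for C
  proof -
    have "emeasure M C < \<infinity>"
      using emeasure_mono[OF that(2) F(1)] F(3) by (rule le_less_trans)
    then show ?thesis
      using that(3) by (simp add: measure_def enn2real_positive_iff)
  qed
  have pos: "0 < measure M A" "0 < measure M B" "0 < measure M F"
    by (rule measure_pos[OF A], rule measure_pos[OF B], rule measure_pos[OF F(1) order_refl F(2)])
  define u where "u = return_rate M T F"
  define a where "a = return_sequence M T F"
  \<comment> \<open>Which intersection is empty depends on \<open>k\<close>, so the constant is the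
    smaller of the two products.\<close>
  define c where "c = min (measure M A * measure M A) (measure M A * measure M B)"
  define e where "e = (\<lambda>C k. \<bar>measure M (A \<inter> (T ^^ k) -` C) - measure M A * measure M C * u k\<bar>)"
  have c: "0 < c"
    unfolding c_def using pos by simp
  have u: "0 \<le> u k" for k
    by (simp add: u_def return_rate_def)
  have error: "c * u k \<le> e A k + e B k" for k
  proof -
    have "c * u k \<le> measure M A * measure M A * u k" "c * u k \<le> measure M A * measure M B * u k"
      unfolding c_def using u[of k] by (intro mult_right_mono; simp)+
    moreover have "0 \<le> e A k" "0 \<le> e B k"
      by (simp_all add: e_def)
    moreover have "measure M A * measure M A * u k \<le> e A k" if "A \<inter> (T ^^ k) -` A = {}"
      unfolding e_def that by simp
    moreover have "measure M A * measure M B * u k \<le> e B k" if "A \<inter> (T ^^ k) -` B = {}"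
      unfolding e_def that by simp
    ultimately show ?thesis
      using disj[rule_format, of k] by linarith
  qed
  \<comment> \<open>For \<open>n \<ge> 1\<close> the return sequence contains the term
    \<open>u 0\<close>, the reciprocal of the measure of \<open>F\<close>. This makes the
    denominator positive.\<close>
  have bound: "c \<le> 1 / a n * sum (e A) {..<n} + 1 / a n * sum (e B) {..<n}" if n: "1 \<le> n" for n
  proof -
    have "0 < u 0"
      using pos by (simp add: u_def return_rate_def)
    also have "u 0 \<le> a n"
      unfolding a_def return_sequence_def
      unfolding u_def[symmetric] using n u by (intro member_le_sum) simp_all
    finally have a: "0 < a n" .
    have "c * a n = (\<Sum>k<n. c * u k)"
      by (simp add: a_def return_sequence_def u_def sum_distrib_left)
    also have "\<dots> \<le> (\<Sum>k<n. e A k + e B k)"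
      by (intro sum_mono error)
    also have "\<dots> = sum (e A) {..<n} + sum (e B) {..<n}"
      by (rule sum.distrib)
    finally have "c \<le> (sum (e A) {..<n} + sum (e B) {..<n}) / a n"
      using a by (simp only: pos_le_divide_eq)
    then show ?thesis
      by (simp add: add_divide_distrib)
  qed
  have "((\<lambda>n. 1 / a n * sum (e A) {..<n} + 1 / a n * sum (e B) {..<n}) \<longlongrightarrow> 0 + 0)
      (inf sequentially (principal K))"
    unfolding a_def e_def u_def 
    by (rule tendsto_add[OF lim[OF A(1) A(1) A(2) A(2)] lim[OF A(1) B(1) A(2) B(2)]])
  moreover have "eventually (\<lambda>n. c \<le> 1 / a n * sum (e A) {..<n} + 1 / a n * sum (e B) {..<n})
      (inf sequentially (principal K))"
    unfolding eventually_inf_principal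
    using eventually_ge_at_top[of 1] by (rule eventually_mono) (use bound in blast)
  \<comment> \<open>The lower bound passes to the limit only along a nontrivial filter, which is
    where \<open>K\<close> being infinite enters.\<close>
  moreover have "inf sequentially (principal K) \<noteq> bot"
  proof
    assume "inf sequentially (principal K) = bot"
    then have "eventually (\<lambda>_. False) (inf sequentially (principal K))"
      by simp
    then have "\<exists>N. \<forall>n\<ge>N. n \<notin> K"
      by (simp add: eventually_inf_principal eventually_sequentially)
    then show False
      using K unfolding infinite_nat_iff_unbounded_le by blast
  qed
  ultimately have "c \<le> 0 + 0"
    by (rule tendsto_lowerbound)
  then show False
    using c by simp
qed

theorem mainTheorem1:
  fixes q :: "nat \<Rightarrow> nat"
  assumes "super_growth_sequence q"
  shows "\<not> subsequence_rationally_weakly_mixing (dyadic_tower_measure q) (dyadic_tower_map q)"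
proof -
  let ?M = "dyadic_tower_measure q"
  let ?T = "dyadic_tower_map q"
  have "\<exists>A\<in>sets ?M. \<exists>B\<in>sets ?M. A \<subseteq> F \<and> B \<subseteq> F \<and> 0 < emeasure ?M A \<and> 0 < emeasure ?M B \<and>
      (\<forall>k. A \<inter> (?T ^^ k) -` A = {} \<or> A \<inter> (?T ^^ k) -` B = {})"
    if F: "F \<in> sets ?M" "0 < emeasure ?M F" for F
  proof -
    obtain i j A B where i: "1 \<le> i" and j: "1 \<le> j"
      and sets: "A \<in> sets ?M" "B \<in> sets ?M" "A \<subseteq> F" "B \<subseteq> F"
        "0 < emeasure ?M A" "0 < emeasure ?M B"
      and A: "A \<subseteq> {x \<in> frequent_zeros. j \<le> dyadic_cocycle q x \<and> x i = 0} \<times> {j}"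
      and B: "B \<subseteq> {x \<in> frequent_zeros. j \<le> dyadic_cocycle q x \<and> x i = 1} \<times> {j}"
      by (rule dyadic_tower_split[OF F])
    \<comment> \<open>Otherwise the same time \<open>k\<close> would change digit \<open>i\<close>
      by 0 along one orbit from \<open>A\<close> and by 1 along another.\<close>
    have "A \<inter> (?T ^^ k) -` A = {} \<or> A \<inter> (?T ^^ k) -` B = {}" for k
    proof (rule ccontr)
      assume "\<not> ?thesis"
      then obtain p p' where p: "p \<in> A" "(?T ^^ k) p \<in> A" "p' \<in> A" "(?T ^^ k) p' \<in> B"
        by blast
      obtain x where x: "p = (x, j)" "x \<in> frequent_zeros" "j \<le> dyadic_cocycle q x" "x i = 0"
        using p(1) A by blast
      obtain x' where x': "p' = (x', j)" "x' \<in> frequent_zeros" "j \<le> dyadic_cocycle q x'" "x' i = 0"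
        using p(3) A by blast
      obtain y where y: "(?T ^^ k) (x, j) = (y, j)" "y i = 0"
        using p(2) A x by blast
      obtain y' where y': "(?T ^^ k) (x', j) = (y', j)" "y' i = 1"
        using p(4) B x' by blast
      have "int (y i) - int (x i) = int (y' i) - int (x' i)"
        using return_time_determines_digits[OF assms] i j x x' y y' by blast
      then show False
        using x x' y y' by simp
    qed
    then show ?thesis
      using sets by blast
  qed
  then have "\<not> rationally_weakly_mixing_along ?M ?T K" if "infinite K" for K
    using not_rationally_weakly_mixing_alongI[OF that, of ?M ?T] by blast
  then show ?thesis
    unfolding subsequence_rationally_weakly_mixing_def by blast
qed

end
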